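(* In the two-dimensional market $\mathcal{M}=\mathbb{R}^2$ with $q=0$, i.e. with aggregate prices $P_i\{\mathbf{x}\}=P_i+\|\mathbf{x}-\mathbf{x}_i\|_2^2-\beta$, $\beta\ge0$, a pure strategy Nash equilibrium $\mathbf{P}^*=(P_i^* )_{i\in\mathcal{N}}\in[0,P_{upper}]^{\mathcal{N}}$ of the pricing game among the companies in $\mathcal{N}$ always exists.
   Context: Market: $\mathcal{M}=\mathbb{R}^2$; each point $\mathbf{x}$ is a customer (uniform, unit density). $\mathcal{N}'$ is the (infinite) set of companies; company $k$ has fixed position $\mathbf{x}_k\in\mathbb{R}^2$. Positions are distinct, every bounded region contains finitely many companies, and there is $r<\infty$ such that every disc of radius $r$ contains at least one company. For a chosen $B>0$, $\mathcal{N}=\{k\in\mathcal{N}' : \|\mathbf{x}_k\|_\infty\le B/2\}$, assumed nonempty (hence finite and nonempty). Only companies in $\mathcal{N}$ are players; every company $j\in\mathcal{N}'\setminus\mathcal{N}$ has a constant price $P_j\equiv P_{j0}\in[0,P_{upper}]$. Each player $i\in\mathcal{N}$ chooses a price $P_i\in[0,P_{upper}]$, where $P_{upper}$ is finite and sufficiently large (larger than some threshold depending on the market data). Aggregate price of company $i$ at customer $\mathbf{x}$: $P_i\{\mathbf{x}\}=P_i+\|\mathbf{x}-\mathbf{x}_i\|_2^2-\beta$. Owners of $\mathbf{x}$: $\mathcal{O}'(\mathbf{x},\mathbf{P})=\operatorname{argmin}_{k\in\mathcal{N}'}P_k\{\mathbf{x}\}$. Market area: $\mathcal{S}_i=\{\mathbf{x}:\mathcal{O}'(\mathbf{x},\mathbf{P})=\{i\}\}$,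 $S_i=|\mathcal{S}_i|$ (planar area). Payoff of $i$: $W_i(\mathbf{P})=P_i\cdot S_i$. A price vector $\mathbf{P}^*$ is a (pure strategy) Nash equilibrium if for each $i\in\mathcal{N}$, $P_i^*$ maximizes $P_i\mapsto W_i(P_i,P_{-i}^* )$ over $[0,P_{upper}]$. *)

theory Defs
  imports "HOL-Analysis.Analysis"
begin

text \<open>
  A market is given by a set \<open>K\<close> of companies and their positions \<open>pos\<close> in the plane.
  A price profile \<open>P\<close> assigns a price to every company; its values
  outside \<open>K\<close> are irrelevant. On \<open>real^2\<close>, \<open>norm\<close> is the Euclidean norm and
  \<open>infnorm\<close> the maximum norm.
\<close>

definition aggregate_price ::
    "('k \<Rightarrow> real^2) \<Rightarrow> real \<Rightarrow> ('k \<Rightarrow> real) \<Rightarrow> 'k \<Rightarrow> real^2 \<Rightarrow> real"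
  where "aggregate_price pos \<beta> P k x = P k + (norm (x - pos k))\<^sup>2 - \<beta>"

definition owners ::
    "'k set \<Rightarrow> ('k \<Rightarrow> real^2) \<Rightarrow> real \<Rightarrow> ('k \<Rightarrow> real) \<Rightarrow> real^2 \<Rightarrow> 'k set"
  where "owners K pos \<beta> P x =
    {k. is_arg_min (\<lambda>k. aggregate_price pos \<beta> P k x) (\<lambda>k. k \<in> K) k}"

definition market_area ::
    "'k set \<Rightarrow> ('k \<Rightarrow> real^2) \<Rightarrow> real \<Rightarrow> ('k \<Rightarrow> real) \<Rightarrow> 'k \<Rightarrow> (real^2) set"
  where "market_area K pos \<beta> P i = {x. owners K pos \<beta> P x = {i}}"

text \<open>
  \<open>measure\<close> would return 0 for an infinite area; this does not occur when the companies meet every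
  disc of some fixed radius and prices are bounded, since all market areas are then bounded.
\<close>

definition payoff ::
    "'k set \<Rightarrow> ('k \<Rightarrow> real^2) \<Rightarrow> real \<Rightarrow> ('k \<Rightarrow> real) \<Rightarrow> 'k \<Rightarrow> real"
  where "payoff K pos \<beta> P i = P i * measure lebesgue (market_area K pos \<beta> P i)"

definition players :: "'k set \<Rightarrow> ('k \<Rightarrow> real^2) \<Rightarrow> real \<Rightarrow> 'k set"
  where "players K pos B = {k \<in> K. infnorm (pos k) \<le> B / 2}"

text \<open>
  An equilibrium is a vector indexed by the players \<open>N\<close> only (an extensional function on \<open>N\<close>);
  \<open>override_on P0 P N\<close> completes it with the constant prices \<open>P0\<close> of the other companies.
\<close>

definition nash_equilibrium ::
    "'k set \<Rightarrow> ('k \<Rightarrow> real^2) \<Rightarrow> real \<Rightarrow> 'k set \<Rightarrow> real \<Rightarrow> ('k \<Rightarrow> real) \<Rightarrow> ('k \<Rightarrow> real) \<Rightarrow> bool"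
  where "nash_equilibrium K pos \<beta> N P_upper P0 P \<longleftrightarrow>
    P \<in> N \<rightarrow>\<^sub>E {0..P_upper} \<and>
    (\<forall>i\<in>N. is_arg_max (\<lambda>p. payoff K pos \<beta> (override_on P0 (P(i := p)) N) i)
                      (\<lambda>p. p \<in> {0..P_upper}) (P i))"

end

theory Submission
  imports Defs
begin

text \<open>
  As a function of its own price \<open>p\<close>, the market area of a company is a superlevel set \<open>{h > p}\<close>,
  where \<open>h\<close> is a minimum of affine functions. By the Brunn-Minkowski inequality the area \<open>S p\<close>
  therefore satisfies \<open>S p * S q \<le> (S ((p + q) / 2))\<^sup>2\<close>, whereas \<open>p * q < ((p + q) / 2)\<^sup>2\<close> for
  \<open>p \<noteq> q\<close>. At low positive prices a company sells at least around its own position, so the maximal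
  payoff is positive and hence attained at a single price. Payoffs are continuous because bisectors
  have measure zero, so the best reply map is continuous and Brouwer's theorem gives an
  equilibrium, for every positive price bound.
\<close>

subsection \<open>The Brunn-Minkowski inequality in the plane\<close>

text \<open>For \<open>a\<close> near the supremum of \<open>A\<close> and \<open>b\<close> near the
  infimum of \<open>B\<close>, the translates \<open>A + b\<close> and \<open>B + a\<close> lie in
  \<open>M\<close> and overlap at most in an interval of length \<open>e\<close>. An arbitrary Borel
  superset \<open>M\<close> replaces the sumset, which need not be Borel.\<close>

lemma brunn_minkowski_real:
  fixes A B M :: "real set"
  assumes [measurable]: "A \<in> sets borel" "B \<in> sets borel" "M \<in> sets borel"
    and "A \<noteq> {}" "B \<noteq> {}" "bounded A" "bounded B"
    and sum: "\<And>x y. x \<in> A \<Longrightarrow> y \<in> B \<Longrightarrow> x + y \<in> M"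
  shows "emeasure lborel A + emeasure lborel B \<le> emeasure lborel M"
proof (rule ennreal_le_epsilon)
  fix e :: real assume e: "e > 0"
  have bdd: "bdd_above A" "bdd_below B"
    using assms by (auto intro: bounded_imp_bdd_above bounded_imp_bdd_below)
  obtain a where a: "a \<in> A" "Sup A - e / 2 < a"
    using less_cSup_iff[OF \<open>A \<noteq> {}\<close> bdd(1), of "Sup A - e / 2"] e by auto
  obtain b where b: "b \<in> B" "b < Inf B + e / 2"
    using cInf_less_iff[OF \<open>B \<noteq> {}\<close> bdd(2), of "Inf B + e / 2"] e by auto
  \<comment> \<open>\<open>s\<close> bounds \<open>B + a\<close> from below, while
    \<open>A + b\<close> stays below \<open>s + e\<close>: the two errors \<open>e / 2\<close> add
    up.\<close>
  define s where "s = a + Inf B"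
  have shift: "emeasure lborel S = emeasure lborel {z. z - c \<in> S}" if [measurable]: "S \<in> sets borel" for S :: "real set" and c
  proof -
    have "emeasure lborel S = emeasure (distr lborel borel ((+) (- c))) S"
      by (simp add: lborel_distr_plus)
    also have "\<dots> = emeasure lborel ((+) (- c) -` S)"
      by (subst emeasure_distr) auto
    also have "(+) (- c) -` S = {z. z - c \<in> S}" by auto
    finally show ?thesis .
  qed
  define A' where "A' = {z. z - b \<in> A}"
  define B' where "B' = {z. z - a \<in> B}"
  have [measurable]: "A' \<in> sets borel" "B' \<in> sets borel" unfolding A'_def B'_def by measurable
  have sub: "A' \<union> B' \<subseteq> M" using sum a(1) b(1) by (force simp: A'_def B'_def)
  have B's: "s \<le> z" if "z \<in> B'" for z
    using cInf_lower[OF _ bdd(2), of "z - a"] that by (auto simp: B'_def s_def)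
  have A's: "z \<le> s + e" if "z \<in> A'" for z
    using cSup_upper[OF _ bdd(1), of "z - b"] that a(2) b(2) by (auto simp: A'_def s_def)
  have "emeasure lborel A + emeasure lborel B = emeasure lborel A' + emeasure lborel B'"
    using shift[of A b] shift[of B a] by (simp add: A'_def B'_def)
  also have "\<dots> = emeasure lborel (A' \<union> B') + emeasure lborel (A' \<inter> B')"
    by (rule emeasure_Un_Int) auto
  also have "\<dots> \<le> emeasure lborel M + emeasure lborel {s..s + e}"
    using sub A's B's by (intro add_mono emeasure_mono) auto
  also have "\<dots> = emeasure lborel M + ennreal e" using e by simp
  finally show "emeasure lborel A + emeasure lborel B \<le> emeasure lborel M + ennreal e" .
qed

text \<open>Fubini for the region under the graph of \<open>f\<close>, with heights measured in
  units of \<open>c\<close>. The guard \<open>0 < s\<close> confines the integral over the whole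
  line to positive heights.\<close>

lemma nn_integral_layer_cake:
  fixes f :: "real \<Rightarrow> real"
  assumes [measurable]: "f \<in> borel_measurable borel" and f: "\<And>x. 0 \<le> f x" and c: "c > 0"
  shows "(\<integral>\<^sup>+x. f x \<partial>lborel) = c * (\<integral>\<^sup>+s. emeasure lborel {x. 0 < s \<and> c * s < f x} \<partial>lborel)"
proof -
  have eq: "indicator {(x, s). 0 < s \<and> c * s < f x} (x, s) = (indicator {s. 0 < s \<and> c * s < f x} s :: ennreal)"
    "indicator {(x, s). 0 < s \<and> c * s < f x} (x, s) = (indicator {x. 0 < s \<and> c * s < f x} x :: ennreal)" for x s
    by (auto simp: indicator_def)
  have "(\<integral>\<^sup>+x. f x \<partial>lborel) = (\<integral>\<^sup>+x. c * (\<integral>\<^sup>+s. indicator {(x, s). 0 < s \<and> c * s < f x} (x, s) \<partial>lborel) \<partial>lborel)"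
  proof (rule nn_integral_cong)
    fix x
    have "{s. 0 < s \<and> c * s < f x} = {0<..<f x / c}" using c by (auto simp: field_simps)
    then have "ennreal (f x) = c * (\<integral>\<^sup>+s. indicator {s. 0 < s \<and> c * s < f x} s \<partial>lborel)"
      using c f[of x] by (simp add: ennreal_mult[symmetric])
    then show "ennreal (f x) = c * (\<integral>\<^sup>+s. indicator {(x, s). 0 < s \<and> c * s < f x} (x, s) \<partial>lborel)"
      unfolding eq .
  qed
  also have "\<dots> = c * (\<integral>\<^sup>+x. \<integral>\<^sup>+s. indicator {(x, s). 0 < s \<and> c * s < f x} (x, s) \<partial>lborel \<partial>lborel)"
    by (subst nn_integral_cmult) auto
  also have "\<dots> = c * (\<integral>\<^sup>+s. \<integral>\<^sup>+x. indicator {(x, s). 0 < s \<and> c * s < f x} (x, s) \<partial>lborel \<partial>lborel)"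
    by (subst lborel_pair.Fubini') auto
  also have "\<dots> = c * (\<integral>\<^sup>+s. (\<integral>\<^sup>+x. indicator {x. 0 < s \<and> c * s < f x} x \<partial>lborel) \<partial>lborel)"
    unfolding eq(2) ..
  also have "\<dots> = c * (\<integral>\<^sup>+s. emeasure lborel {x. 0 < s \<and> c * s < f x} \<partial>lborel)"
    by simp
  finally show ?thesis .
qed

text \<open>Level sets are sections of one measurable planar set. This allows the integrals of two
  such functions to be added.\<close>

lemma borel_measurable_level_measure:
  fixes f :: "real \<Rightarrow> real"
  assumes [measurable]: "f \<in> borel_measurable borel"
  shows "(\<lambda>l. emeasure lborel {s. 0 < l \<and> c * l < f s}) \<in> borel_measurable lborel"
proof -
  have "Measurable.pred (lborel \<Otimes>\<^sub>M lborel) (\<lambda>z. 0 < fst z \<and> c * fst z < f (snd z))"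
    by measurable
  then have "(\<lambda>l. emeasure lborel (Pair l -` {z. 0 < fst z \<and> c * fst z < f (snd z)})) \<in> borel_measurable lborel"
    by (intro lborel.measurable_emeasure_Pair) (simp add: pred_def space_pair_measure)
  then show ?thesis by (simp add: vimage_def)
qed

text \<open>Only a multiplicative form of the Brunn-Minkowski inequality is needed. Dividing the slice
  lengths of \<open>A\<close> and \<open>B\<close> by their suprema makes the superlevel sets at each height simultaneously
  nonempty, so that the one-dimensional inequality applies both to slices and to superlevel sets.\<close>

lemma brunn_minkowski_prod:
  fixes A B M :: "(real \<times> real) set"
  assumes sets: "A \<in> sets borel" "B \<in> sets borel" "M \<in> sets borel"
    and bdd: "bounded A" "bounded B" "bounded M"
    and sum: "\<And>x y. x \<in> A \<Longrightarrow> y \<in> B \<Longrightarrow> x + y \<in> M"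
  shows "16 * (measure lborel A * measure lborel B) \<le> (measure lborel M)\<^sup>2"
proof -
  \<comment> \<open>Slices of bounded sets have finite length, so the default value 0 of
    \<open>measure\<close> at infinity is never met.\<close>
  define len where "len S s = measure lborel {y. (s, y) \<in> S}" for S :: "(real \<times> real) set" and s :: real
  have sets_prod: "sets (lborel \<Otimes>\<^sub>M lborel) = sets (borel :: (real \<times> real) measure)"
    by (subst lborel_prod) simp
  have slice_sets: "{y. (s, y) \<in> S} \<in> sets borel" if "S \<in> sets borel" for S :: "(real \<times> real) set" and s :: real
    using that by measurable
  have slice_bdd: "bounded {y. (s, y) \<in> S}" if "bounded S" for S :: "(real \<times> real) set" and s
    by (rule bounded_subset[OF bounded_snd[OF that]]) force
  have em: "emeasure lborel {y. (s, y) \<in> S} = len S s" if "bounded S" for S :: "(real \<times> real) set" and s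
    using emeasure_bounded_finite[OF slice_bdd[OF that]] by (simp add: len_def emeasure_eq_ennreal_measure less_top)
  have len0: "0 \<le> len S s" for S s by (simp add: len_def)
  have meas: "len S \<in> borel_measurable borel" if "S \<in> sets borel" for S
  proof -
    have "(\<lambda>s. emeasure lborel (Pair s -` S)) \<in> borel_measurable lborel"
      by (rule lborel.measurable_emeasure_Pair) (use that sets_prod in blast)
    then show ?thesis by (simp add: len_def[abs_def] measure_def vimage_def)
  qed
  have int: "ennreal (measure lborel S) = (\<integral>\<^sup>+s. len S s \<partial>lborel)" if "S \<in> sets borel" "bounded S" for S
  proof -
    have "ennreal (measure lborel S) = emeasure lborel S"
      using emeasure_bounded_finite[OF that(2)] by (simp add: emeasure_eq_ennreal_measure less_top)
    also have "\<dots> = emeasure (lborel \<Otimes>\<^sub>M lborel) S" by (simp add: lborel_prod)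
    also have "\<dots> = (\<integral>\<^sup>+s. emeasure lborel (Pair s -` S) \<partial>lborel)"
      by (rule lborel.emeasure_pair_measure_alt) (use that sets_prod in blast)
    also have "\<dots> = (\<integral>\<^sup>+s. len S s \<partial>lborel)"
      by (simp add: vimage_def em[OF that(2)])
    finally show ?thesis .
  qed
  have bound: "\<exists>C. \<forall>s. len S s \<le> C" if S: "S \<in> sets borel" "bounded S" for S
  proof -
    let ?I = "snd ` S"
    obtain C where C: "\<And>z. z \<in> ?I \<Longrightarrow> \<bar>z\<bar> \<le> C"
      using bounded_snd[OF S(2)] unfolding bounded_iff real_norm_def by blast
    have "len S s \<le> measure lborel {-C..C}" for s
      unfolding len_def
    proof (rule measure_mono_fmeasurable)
      show "{y. (s, y) \<in> S} \<subseteq> {-C..C}" using C by force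
      show "{-C..C} \<in> fmeasurable lborel"
        by (intro fmeasurableI emeasure_bounded_finite) auto
    qed (use slice_sets[OF S(1)] in simp)
    then show ?thesis by blast
  qed
  show ?thesis
  \<comment> \<open>With a null factor the left side is 0. Otherwise both suprema of slice lengths
    are positive and can serve as divisors.\<close>
  proof (cases "measure lborel A = 0 \<or> measure lborel B = 0")
    case True
    then show ?thesis by auto
  next
    case False
    have Sup_len: "bdd_above (range (len S)) \<and> 0 < Sup (range (len S))"
      if S: "S \<in> sets borel" "bounded S" "measure lborel S \<noteq> 0" for S
    proof -
      have b: "bdd_above (range (len S))" using bound[OF S(1,2)] by (auto intro: bdd_aboveI)
      have "\<exists>s. len S s > 0"
      proof (rule ccontr)
        assume "\<not> ?thesis"
        then have "len S s = 0" for s using len0[of S s] by (meson antisym_conv not_le)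
        then have "ennreal (measure lborel S) = 0" using int[OF S(1,2)] by simp
        with S(3) show False by (simp add: measure_nonneg order_antisym ennreal_eq_0_iff)
      qed
      then show ?thesis using b cSUP_upper[OF UNIV_I b] by (meson less_le_trans)
    qed
    define a where "a = Sup (range (len A))"
    define b where "b = Sup (range (len B))"
    have a: "bdd_above (range (len A))" "0 < a" and b: "bdd_above (range (len B))" "0 < b"
      using Sup_len[OF sets(1) bdd(1)] Sup_len[OF sets(2) bdd(2)] False unfolding a_def b_def by auto
    \<comment> \<open>Geometric mean of the suprema: by AM-GM, slices longer than
      \<open>a * l\<close> and \<open>b * l\<close> have total length above
      \<open>2 * g * l\<close>.\<close>
    define g where "g = sqrt (a * b)"
    have g: "g > 0" "g * g = a * b" using a b by (auto simp: g_def)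
    have level: "emeasure lborel {s. 0 < l \<and> a * l < len A s} + emeasure lborel {s. 0 < l \<and> b * l < len B s}
        \<le> emeasure lborel {s. 0 < l \<and> (2 * g) * l < len M s}" (is "_ \<le> emeasure lborel ?M") for l
    \<comment> \<open>At heights strictly between 0 and 1 both level sets on the left are nonempty,
      because \<open>a\<close> and \<open>b\<close> are suprema. At all other heights both are empty
      and the left side is 0.\<close>
    proof (cases "0 < l \<and> l < 1")
      case True
      have nonempty: "{s. 0 < l \<and> c * l < len S s} \<noteq> {}"
        if "c = Sup (range (len S))" "bdd_above (range (len S))" "0 < c" for S c
        using less_cSUP_iff[of UNIV "len S" "c * l"] that True by force
      have levelb: "bounded {s. 0 < l \<and> c * l < len S s}" if S: "bounded S" "0 < c" for S c
      proof (rule bounded_subset[OF bounded_fst[OF S(1)]], rule subsetI)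
        fix s assume "s \<in> {s. 0 < l \<and> c * l < len S s}"
        with S(2) have "len S s > 0" by (auto intro: less_trans[OF mult_pos_pos])
        then have "{y. (s, y) \<in> S} \<noteq> {}" unfolding len_def by (metis less_irrefl measure_empty)
        then show "s \<in> fst ` S" by force
      qed
      show ?thesis
      proof (rule brunn_minkowski_real)
        fix s t assume "s \<in> {s. 0 < l \<and> a * l < len A s}" "t \<in> {s. 0 < l \<and> b * l < len B s}"
        then have st: "a * l < len A s" "b * l < len B t" by auto
        moreover have "0 < a * l" "0 < b * l" using a b True by auto
        ultimately have pos: "0 < len A s" "0 < len B t" by linarith+
        then have ne: "{y. (s, y) \<in> A} \<noteq> {}" "{y. (t, y) \<in> B} \<noteq> {}"
          unfolding len_def by (metis less_irrefl measure_empty)+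
        \<comment> \<open>The inequality on the line is used twice: here for the slices over
          \<open>s\<close> and \<open>t\<close>, and in the enclosing proof for the level sets
          containing \<open>s\<close> and \<open>t\<close>.\<close>
        have "emeasure lborel {y. (s, y) \<in> A} + emeasure lborel {y. (t, y) \<in> B} \<le> emeasure lborel {y. (s + t, y) \<in> M}"
          using sum by (intro brunn_minkowski_real slice_sets slice_bdd sets bdd ne) force
        then have le: "len A s + len B t \<le> len M (s + t)"
          by (simp add: em bdd len0 ennreal_plus[symmetric] del: ennreal_plus)
        have "(2 * g * l)\<^sup>2 = 4 * ((a * l) * (b * l))"
          using g by (simp add: power2_eq_square algebra_simps)
        also have "\<dots> < 4 * (len A s * len B t)"
          using st \<open>0 < a * l\<close> \<open>0 < b * l\<close> by (intro mult_strict_left_mono mult_strict_mono) auto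
        also have "\<dots> \<le> (len A s + len B t)\<^sup>2"
          using zero_le_power2[of "len A s - len B t"] by (simp add: power2_eq_square algebra_simps)
        finally have "2 * g * l < len A s + len B t"
          by (rule power2_less_imp_less) (use pos in auto)
        with le True show "s + t \<in> ?M" by auto
      qed (use meas sets nonempty levelb a b bdd a_def b_def in \<open>simp_all\<close>)
    next
      case False
      have "{s. 0 < l \<and> c * l < len S s} = {}"
        if c: "c = Sup (range (len S))" "bdd_above (range (len S))" "0 < c" for S c
      proof -
        have "len S s \<le> c * l" if "0 < l" for s
        proof -
          have "len S s \<le> c" using cSUP_upper[OF UNIV_I c(2)] c(1) by simp
          also have "c * 1 \<le> c * l" using c(3) False that by (intro mult_left_mono) auto
          finally show ?thesis by simp
        qed
        then show ?thesis by (auto simp: not_less)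
      qed
      from this[OF a_def a] this[OF b_def b] show ?thesis by (simp only: emeasure_empty) simp
    qed
    define IA where "IA = (\<integral>\<^sup>+l. emeasure lborel {s. 0 < l \<and> a * l < len A s} \<partial>lborel)"
    define IB where "IB = (\<integral>\<^sup>+l. emeasure lborel {s. 0 < l \<and> b * l < len B s} \<partial>lborel)"
    have mA: "ennreal (measure lborel A) = a * IA"
      using int[OF sets(1) bdd(1)] nn_integral_layer_cake[OF meas[OF sets(1)] len0 a(2)] by (simp add: IA_def)
    have mB: "ennreal (measure lborel B) = b * IB"
      using int[OF sets(2) bdd(2)] nn_integral_layer_cake[OF meas[OF sets(2)] len0 b(2)] by (simp add: IB_def)
    \<comment> \<open>Division in the extended reals is safe here: an infinite \<open>I\<close>
      would make the finite left side infinite.\<close>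
    have divide: "I = ennreal (m / c)" if "ennreal m = ennreal c * I" "0 < c" "0 \<le> m" for m c I
    proof (cases I)
      case (real r)
      with that show ?thesis by (simp add: ennreal_mult[symmetric])
    next
      case top
      with that show ?thesis by (simp add: ennreal_mult_top)
    qed
    have IA: "IA = ennreal (measure lborel A / a)"
      by (rule divide[OF mA]) (use a in auto)
    have IB: "IB = ennreal (measure lborel B / b)"
      by (rule divide[OF mB]) (use b in auto)
    have "ennreal (2 * g * (measure lborel A / a + measure lborel B / b)) = ennreal (2 * g) * (IA + IB)"
      using a b g by (simp add: IA IB ennreal_mult ennreal_plus)
    also have "IA + IB = (\<integral>\<^sup>+l. emeasure lborel {s. 0 < l \<and> a * l < len A s}
        + emeasure lborel {s. 0 < l \<and> b * l < len B s} \<partial>lborel)"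
      unfolding IA_def IB_def by (rule nn_integral_add[symmetric]) (use borel_measurable_level_measure meas sets in auto)
    also have "ennreal (2 * g) * \<dots> \<le> ennreal (2 * g) * (\<integral>\<^sup>+l. emeasure lborel {s. 0 < l \<and> (2 * g) * l < len M s} \<partial>lborel)"
      by (intro mult_left_mono nn_integral_mono level) simp
    also have "\<dots> = ennreal (measure lborel M)"
      using int[OF sets(3) bdd(3)] nn_integral_layer_cake[OF meas[OF sets(3)] len0, of "2 * g"] g by simp
    finally have le: "2 * g * (measure lborel A / a + measure lborel B / b) \<le> measure lborel M"
      by (simp add: ennreal_le_iff)
    define u where "u = measure lborel A / a"
    define v where "v = measure lborel B / b"
    have uv: "0 \<le> u" "0 \<le> v" using a b by (auto simp: u_def v_def)
    \<comment> \<open>A second AM-GM, \<open>4 * u * v \<le> (u + v)^2\<close>, now for the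
      normalised areas. Since \<open>g * g = a * b\<close>, the normalisation cancels.\<close>
    have "16 * (measure lborel A * measure lborel B) = 4 * (g * g) * (4 * (u * v))"
      using a b g(2) by (simp add: u_def v_def)
    also have "\<dots> \<le> 4 * (g * g) * (u + v)\<^sup>2"
      using zero_le_power2[of "u - v"] g(1) by (intro mult_left_mono) (auto simp: power2_eq_square algebra_simps)
    also have "\<dots> = (2 * g * (u + v))\<^sup>2" by (simp add: power2_eq_square algebra_simps)
    also have "\<dots> \<le> (measure lborel M)\<^sup>2"
      using le g uv by (intro power_mono) (auto simp: u_def v_def)
    finally show ?thesis .
  qed
qed

section \<open>Transfer of the inequality from pairs to \<open>real^2\<close>\<close>

definition vec_of_pair :: "real \<times> real \<Rightarrow> real^2"
  where "vec_of_pair z = (\<chi> i. if i = 1 then fst z else snd z)"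

lemma borel_measurable_vec_of_pair [measurable]: "vec_of_pair \<in> borel_measurable borel"
proof (rule borel_measurable_continuous_onI)
  have "continuous_on UNIV (\<lambda>z :: real \<times> real. if i = 1 then fst z else snd z)" for i :: 2
    by (cases "i = 1") (auto intro!: continuous_intros)
  then show "continuous_on UNIV vec_of_pair"
    unfolding vec_of_pair_def by (rule continuous_on_vec_lambda)
qed

text \<open>Preimages of boxes are rectangles with the same side lengths, and \<open>lborel\<close>
  is determined by its values on boxes.\<close>

lemma lborel_vec_of_pair: "lborel = distr lborel borel vec_of_pair"
proof (rule lborel_eqI)
  fix l u :: "real^2" assume lu: "\<And>b. b \<in> Basis \<Longrightarrow> l \<bullet> b \<le> u \<bullet> b"
  have le: "l $ i \<le> u $ i" for i
    using lu[of "axis i 1"] by (simp add: inner_axis)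
  have vimage: "vec_of_pair -` box l u = {l$1<..<u$1} \<times> {l$2<..<u$2}"
    by (auto simp: vec_of_pair_def mem_box_cart forall_2)
  have "emeasure (distr lborel borel vec_of_pair) (box l u) = emeasure (lborel \<Otimes>\<^sub>M lborel) ({l$1<..<u$1} \<times> {l$2<..<u$2})"
    by (subst emeasure_distr) (auto simp: vimage lborel_prod)
  also have "\<dots> = ennreal ((u$1 - l$1) * (u$2 - l$2))"
    by (subst lborel.emeasure_pair_measure_Times) (auto simp: le ennreal_mult)
  also have "(u$1 - l$1) * (u$2 - l$2) = (\<Prod>b\<in>Basis. (u - l) \<bullet> b)"
    by (simp add: Basis_vec_def UNION_singleton_eq_range prod.reindex inj_on_def axis_eq_axis UNIV_2 inner_axis)
  finally show "emeasure (distr lborel borel vec_of_pair) (box l u) = ennreal (\<Prod>b\<in>Basis. (u - l) \<bullet> b)" .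
qed simp

text \<open>\<open>vec_of_pair\<close> is additive and preserves norm and measure, so all hypotheses
  pull back to pairs.\<close>

lemma brunn_minkowski_plane:
  fixes A B M :: "(real^2) set"
  assumes sets: "A \<in> sets borel" "B \<in> sets borel" "M \<in> sets borel"
    and bdd: "bounded A" "bounded B" "bounded M"
    and sum: "\<And>x y. x \<in> A \<Longrightarrow> y \<in> B \<Longrightarrow> x + y \<in> M"
  shows "16 * (measure lborel A * measure lborel B) \<le> (measure lborel M)\<^sup>2"
proof -
  have v_norm: "norm z = norm (vec_of_pair z)" for z
    by (simp add: vec_of_pair_def norm_prod_def norm_vec_def L2_set_def UNIV_2)
  have v_sets: "vec_of_pair -` S \<in> sets borel" if "S \<in> sets borel" for S
    using measurable_sets[OF borel_measurable_vec_of_pair that] by simp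
  have v_bdd: "bounded (vec_of_pair -` S)" if "bounded S" for S
    using that unfolding bounded_iff by (auto simp: v_norm)
  have v_measure: "measure lborel S = measure lborel (vec_of_pair -` S)" if "S \<in> sets borel" for S
    by (subst lborel_vec_of_pair, subst measure_distr) (use borel_measurable_vec_of_pair that in auto)
  have "vec_of_pair (x + y) = vec_of_pair x + vec_of_pair y" for x y by (simp add: vec_of_pair_def vec_eq_iff)
  then show ?thesis
    unfolding v_measure[OF sets(1)] v_measure[OF sets(2)] v_measure[OF sets(3)]
    using sum by (intro brunn_minkowski_prod v_sets v_bdd sets bdd) auto
qed

text \<open>A sum is twice a midpoint and hence lies in the dilate of \<open>M\<close> by 2. The
  dilation multiplies area by 4, and squaring this cancels the 16.\<close>

lemma brunn_minkowski_midpoint: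
  fixes A B M :: "(real^2) set"
  assumes sets: "A \<in> sets borel" "B \<in> sets borel" "M \<in> sets borel"
    and bdd: "bounded A" "bounded B" "bounded M"
    and mid: "\<And>x y. x \<in> A \<Longrightarrow> y \<in> B \<Longrightarrow> midpoint x y \<in> M"
  shows "measure lebesgue A * measure lebesgue B \<le> (measure lebesgue M)\<^sup>2"
proof -
  have scaled: "(*\<^sub>R) 2 ` M \<in> sets borel"
  proof -
    have "(*\<^sub>R) 2 ` M = (*\<^sub>R) (1/2) -` M" by (force simp: image_iff)
    also have "\<dots> \<in> sets borel"
      using measurable_sets[of "(*\<^sub>R) (1/2)" borel borel M] sets(3) by simp
    finally show ?thesis .
  qed
  have "16 * (measure lborel A * measure lborel B) \<le> (measure lborel ((*\<^sub>R) 2 ` M))\<^sup>2"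
  proof (rule brunn_minkowski_plane[OF sets(1,2) scaled bdd(1,2)])
    show "bounded ((*\<^sub>R) 2 ` M)" using bdd(3) by (rule bounded_scaling)
    show "x + y \<in> (*\<^sub>R) 2 ` M" if "x \<in> A" "y \<in> B" for x y
      using mid[OF that] by (intro image_eqI[of _ _ "midpoint x y"]) (simp_all add: midpoint_def)
  qed
  moreover have "measure lebesgue ((*\<^sub>R) 2 ` M) = 4 * measure lebesgue M"
  proof -
    have "M \<in> lmeasurable"
      using sets(3) bdd(3) by (intro bounded_set_imp_lmeasurable) (auto intro: sets_completionI_sets)
    from measure_stretch[OF this, of "\<lambda>_. 2"] show ?thesis
      by (simp add: scaleR_vec_def[abs_def])
  qed
  ultimately show ?thesis
    using sets scaled by (simp add: measure_completion power2_eq_square)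
qed

subsection \<open>Equilibria from unique best replies\<close>

text \<open>Bolzano-Weierstrass, one coordinate at a time: each new coordinate costs a further
  subsequence.\<close>

lemma bounded_finite_coords_convergent_subseq:
  fixes X :: "nat \<Rightarrow> 'k \<Rightarrow> real"
  assumes "finite N" and "\<And>n i. i \<in> N \<Longrightarrow> X n i \<in> {0..c}"
  shows "\<exists>L r. strict_mono (r :: nat \<Rightarrow> nat) \<and> (\<forall>i\<in>N. (\<lambda>n. X (r n) i) \<longlonglongrightarrow> L i)"
  using assms
proof (induction N rule: finite_induct)
  case empty
  then show ?case using strict_mono_id by blast
next
  case (insert a N)
  then obtain L r where r: "strict_mono (r :: nat \<Rightarrow> nat)"
    and L: "\<And>i. i \<in> N \<Longrightarrow> (\<lambda>n. X (r n) i) \<longlonglongrightarrow> L i"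
    by force
  have "\<forall>n. X (r n) a \<in> {0..c}"
    using insert.prems by blast
  then obtain l s where s: "strict_mono (s :: nat \<Rightarrow> nat)" "((\<lambda>n. X (r n) a) \<circ> s) \<longlonglongrightarrow> l"
    using compact_Icc[of 0 c] unfolding compact_eq_seq_compact_metric seq_compact_def by meson
  have "(\<lambda>n. X ((r \<circ> s) n) i) \<longlonglongrightarrow> (L(a := l)) i" if "i \<in> insert a N" for i
  proof (cases "i = a")
    case True
    then show ?thesis using s by (simp add: o_def)
  next
    case False
    with that have "i \<in> N" by blast
    from LIMSEQ_subseq_LIMSEQ[OF L[OF this] s(1)] False show ?thesis by (simp add: o_def)
  qed
  then show ?case using strict_mono_o[OF r s(1)] by blast
qed

text \<open>The library's Brouwer theorem fixes the dimension by a type, whereas the number of players is a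
  term; Kuhn's combinatorial lemma has the dimension as a natural number.\<close>

lemma brouwer_nat_cube:
  fixes F :: "(nat \<Rightarrow> real) \<Rightarrow> nat \<Rightarrow> real"
  assumes maps: "\<And>x i. \<forall>j<n. x j \<in> {0..1} \<Longrightarrow> i < n \<Longrightarrow> F x i \<in> {0..1}"
    and cont: "\<And>X x i. \<lbrakk>\<forall>k. \<forall>j<n. X k j \<in> {0..1}; \<forall>j<n. (\<lambda>k. X k j) \<longlonglongrightarrow> x j; i < n\<rbrakk>
                 \<Longrightarrow> (\<lambda>k. F (X k) i) \<longlonglongrightarrow> F x i"
  shows "\<exists>x. (\<forall>j<n. x j \<in> {0..1}) \<and> (\<forall>i<n. F x i = x i)"
proof -
  \<comment> \<open>Grid points of the unit cube with mesh \<open>1 / (k + 1)\<close>.\<close>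
  define scale where "scale k y = (\<lambda>j. real (y j) / real (Suc k))" for k and y :: "nat \<Rightarrow> nat"
  have scale: "\<forall>j<n. scale k y j \<in> {0..1}" if "\<forall>j<n. y j \<le> Suc k" for k y
    using that by (auto simp: scale_def divide_simps)
  \<comment> \<open>The grid cube with corner \<open>q\<close> is an approximate fixed point: in
    every coordinate the displacement of \<open>F\<close> is nonnegative at one vertex and
    nonpositive at another.\<close>
  have "\<exists>q. (\<forall>i<n. q i < Suc k) \<and>
      (\<forall>i<n. \<exists>u v. (\<forall>j<n. q j \<le> u j \<and> u j \<le> q j + 1) \<and> (\<forall>j<n. q j \<le> v j \<and> v j \<le> q j + 1) \<and>
        scale k u i \<le> F (scale k u) i \<and> F (scale k v) i \<le> scale k v i)" for k
  proof -
    \<comment> \<open>Label 0 means that \<open>F\<close> pushes the coordinate up. Kuhn's lemma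
      requires 0 on the lower face, which is imposed by hand and is harmless since \<open>F\<close>
      is nonnegative there; on the upper face \<open>F\<close> is at most 1, which yields the
      required 1.\<close>
    define label where
      "label y i = (if y i = 0 \<or> scale k y i < F (scale k y) i then 0 else 1 :: nat)" for y :: "nat \<Rightarrow> nat" and i
    have l0: "scale k y i \<le> F (scale k y) i" if "label y i = 0" "\<forall>j<n. y j \<le> Suc k" "i < n" for y i
      using that maps[OF scale[OF that(2)] that(3)] by (auto simp: label_def scale_def split: if_splits)
    have l1: "F (scale k y) i \<le> scale k y i" if "label y i \<noteq> 0" for y i
      using that by (auto simp: label_def split: if_splits)
    have top: "label y i = 1" if "\<forall>j<n. y j \<le> Suc k" "i < n" "y i = Suc k" for y i
      using that maps[OF scale[OF that(1)] that(2)] by (auto simp: label_def scale_def divide_simps split: if_splits)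
    obtain q where q: "\<forall>i<n. q i < Suc k"
      "\<forall>i<n. \<exists>r s. (\<forall>j<n. q j \<le> r j \<and> r j \<le> q j + 1) \<and> (\<forall>j<n. q j \<le> s j \<and> s j \<le> q j + 1) \<and> label r i \<noteq> label s i"
    proof (rule kuhn_lemma[of "Suc k" n label])
      show "\<forall>x. (\<forall>i<n. x i \<le> Suc k) \<longrightarrow> (\<forall>i<n. x i = Suc k \<longrightarrow> label x i = 1)"
        using top by blast
    qed (auto simp: label_def)
    have "\<exists>u v. (\<forall>j<n. q j \<le> u j \<and> u j \<le> q j + 1) \<and> (\<forall>j<n. q j \<le> v j \<and> v j \<le> q j + 1) \<and>
        scale k u i \<le> F (scale k u) i \<and> F (scale k v) i \<le> scale k v i" if i: "i < n" for i
    proof -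
      have ub: "\<forall>j<n. r j \<le> Suc k" if "\<forall>j<n. q j \<le> r j \<and> r j \<le> q j + 1" for r
        using that q(1) by (metis Suc_eq_plus1 Suc_leI le_trans)
      obtain r s where rs: "\<forall>j<n. q j \<le> r j \<and> r j \<le> q j + 1" "\<forall>j<n. q j \<le> s j \<and> s j \<le> q j + 1"
        "label r i \<noteq> label s i"
        using q(2) i by blast
      show ?thesis
      proof (cases "label r i = 0")
        case True
        then show ?thesis using rs l0[OF True ub[OF rs(1)] i] l1[of s i] by metis
      next
        case False
        then have s0: "label s i = 0" using rs(3) by (auto simp: label_def split: if_splits)
        show ?thesis using rs l0[OF s0 ub[OF rs(2)] i] l1[OF False] by blast
      qed
    qed
    with q(1) show ?thesis by blast
  qed
  then obtain q where q: "\<And>k i. i < n \<Longrightarrow> q k i < Suc k"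
    and "\<And>k. \<forall>i<n. \<exists>u v. (\<forall>j<n. q k j \<le> u j \<and> u j \<le> q k j + 1) \<and> (\<forall>j<n. q k j \<le> v j \<and> v j \<le> q k j + 1) \<and>
        scale k u i \<le> F (scale k u) i \<and> F (scale k v) i \<le> scale k v i"
    by metis
  then obtain u v where
        u: "\<And>k i j. i < n \<Longrightarrow> j < n \<Longrightarrow> q k j \<le> u k i j \<and> u k i j \<le> q k j + 1"
    and v: "\<And>k i j. i < n \<Longrightarrow> j < n \<Longrightarrow> q k j \<le> v k i j \<and> v k i j \<le> q k j + 1"
    and uF: "\<And>k i. i < n \<Longrightarrow> scale k (u k i) i \<le> F (scale k (u k i)) i"
    and vF: "\<And>k i. i < n \<Longrightarrow> F (scale k (v k i)) i \<le> scale k (v k i) i"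
    by metis
  have "scale k (q k) i \<in> {0..1}" if "i \<in> {..<n}" for k i
    using scale[of "q k" k] q that by (simp add: less_imp_le)
  from bounded_finite_coords_convergent_subseq[of "{..<n}" "\<lambda>k. scale k (q k)", OF _ this]
  obtain x r where r: "strict_mono (r :: nat \<Rightarrow> nat)"
    and x: "\<And>i. i < n \<Longrightarrow> (\<lambda>k. scale (r k) (q (r k)) i) \<longlonglongrightarrow> x i"
    by auto
  have x01: "\<forall>j<n. x j \<in> {0..1}"
  proof safe
    fix j assume j: "j < n"
    have "\<forall>k. scale (r k) (q (r k)) j \<in> {0..1}"
      using scale q j by (simp add: less_imp_le)
    then show "x j \<in> {0..1}"
      using closed_sequentially[OF _ _ x[OF j], of "{0..1}"] by simp
  qed
  \<comment> \<open>The mesh tends to 0, so any choice of vertices of the cubes has the same limit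
    as the corners.\<close>
  have near: "(\<lambda>k. scale (r k) (w (r k)) j) \<longlonglongrightarrow> x j"
    if "j < n" "\<And>k. q k j \<le> w k j \<and> w k j \<le> q k j + 1" for j and w :: "nat \<Rightarrow> nat \<Rightarrow> nat"
  proof (rule tendsto_sandwich)
    show "\<forall>\<^sub>F k in sequentially. scale (r k) (q (r k)) j \<le> scale (r k) (w (r k)) j"
      using that(2) by (auto simp: scale_def divide_right_mono)
    have "real (w k j) \<le> real (q k j) + 1" for k
      using that(2)[of k] by linarith
    then show "\<forall>\<^sub>F k in sequentially.
        scale (r k) (w (r k)) j \<le> scale (r k) (q (r k)) j + inverse (real (Suc (r k)))"
      by (auto simp: scale_def field_simps simp del: of_nat_Suc)
    show "(\<lambda>k. scale (r k) (q (r k)) j) \<longlonglongrightarrow> x j" by (rule x[OF that(1)])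
    have "(\<lambda>k. inverse (real (Suc (r k)))) \<longlonglongrightarrow> 0"
      using LIMSEQ_subseq_LIMSEQ[OF LIMSEQ_inverse_real_of_nat r] by (simp add: o_def)
    from tendsto_add[OF x[OF that(1)] this]
    show "(\<lambda>k. scale (r k) (q (r k)) j + inverse (real (Suc (r k)))) \<longlonglongrightarrow> x j" by simp
  qed
  have lim: "(\<lambda>k. F (scale (r k) (w (r k))) i) \<longlonglongrightarrow> F x i"
    if i: "i < n" and w: "\<And>k j. j < n \<Longrightarrow> q k j \<le> w k j \<and> w k j \<le> q k j + 1" for i and w :: "nat \<Rightarrow> nat \<Rightarrow> nat"
  proof (rule cont)
    have "w k j \<le> Suc k" if "j < n" for k j
      using w[OF that, of k] q[OF that, of k] by linarith
    then show "\<forall>k. \<forall>j<n. scale (r k) (w (r k)) j \<in> {0..1}"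
      using scale by blast
    show "\<forall>j<n. (\<lambda>k. scale (r k) (w (r k)) j) \<longlonglongrightarrow> x j"
      using near w by blast
  qed (rule i)
  \<comment> \<open>The vertices \<open>u\<close> and \<open>v\<close> have the common limit
    \<open>x\<close>, so their opposite weak inequalities become an equality.\<close>
  have "F x i = x i" if i: "i < n" for i
  proof (rule antisym)
    show "F x i \<le> x i"
      by (rule LIMSEQ_le[OF lim[OF i, of "\<lambda>k. v k i"] near[OF i, of "\<lambda>k. v k i"]])
         (use v i vF in blast)+
    show "x i \<le> F x i"
      by (rule LIMSEQ_le[OF near[OF i, of "\<lambda>k. u k i"] lim[OF i, of "\<lambda>k. u k i"]])
         (use u i uF in blast)+
  qed
  with x01 show ?thesis by blast
qed

text \<open>Coordinates are enumerated by \<open>e\<close>, with inverse \<open>d\<close>, and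
  rescaled by \<open>c\<close>.\<close>

lemma brouwer_finite_cube:
  fixes F :: "('k \<Rightarrow> real) \<Rightarrow> 'k \<Rightarrow> real"
  assumes "finite N" and c: "c > 0"
    and maps: "\<And>x i. \<forall>j\<in>N. x j \<in> {0..c} \<Longrightarrow> i \<in> N \<Longrightarrow> F x i \<in> {0..c}"
    and cont: "\<And>X x i. \<lbrakk>\<forall>k. \<forall>j\<in>N. X k j \<in> {0..c}; \<forall>j\<in>N. (\<lambda>k. X k j) \<longlonglongrightarrow> x j; i \<in> N\<rbrakk>
                 \<Longrightarrow> (\<lambda>k. F (X k) i) \<longlonglongrightarrow> F x i"
  shows "\<exists>x. (\<forall>j\<in>N. x j \<in> {0..c}) \<and> (\<forall>i\<in>N. F x i = x i)"
proof -
  obtain e where e: "bij_betw e {..<card N} N"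
    using bij_betw_from_nat_into_finite[OF assms(1)] by blast
  define d where "d = the_inv_into {..<card N} e"
  have de: "d (e i) = i" if "i < card N" for i
    using e that by (simp add: d_def bij_betw_def the_inv_into_f_f)
  have eN: "e i \<in> N" if "i < card N" for i
    using e that by (auto simp: bij_betw_def)
  have dN: "d k < card N" "e (d k) = k" if "k \<in> N" for k
    using e that de unfolding bij_betw_def by force+
  have "\<exists>y. (\<forall>j<card N. y j \<in> {0..1}) \<and> (\<forall>i<card N. F (\<lambda>k. c * y (d k)) (e i) / c = y i)"
  proof (rule brouwer_nat_cube)
    fix x i assume "\<forall>j<card N. x j \<in> {0..1::real}" "i < card N"
    then have "F (\<lambda>k. c * x (d k)) (e i) \<in> {0..c}"
      using dN c by (intro maps eN) (auto simp: mult_left_le)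
    then show "F (\<lambda>k. c * x (d k)) (e i) / c \<in> {0..1}" using c by simp
  next
    fix X x i assume *: "\<forall>k. \<forall>j<card N. X k j \<in> {0..1::real}" "\<forall>j<card N. (\<lambda>k. X k j) \<longlonglongrightarrow> x j" "i < card N"
    have "(\<lambda>k. F (\<lambda>m. c * X k (d m)) (e i)) \<longlonglongrightarrow> F (\<lambda>m. c * x (d m)) (e i)"
      using dN c * by (intro cont eN) (auto simp: mult_left_le intro!: tendsto_intros)
    then show "(\<lambda>k. F (\<lambda>m. c * X k (d m)) (e i) / c) \<longlonglongrightarrow> F (\<lambda>m. c * x (d m)) (e i) / c"
      using c by (intro tendsto_intros) auto
  qed
  then obtain y where y: "\<forall>j<card N. y j \<in> {0..1}" "\<forall>i<card N. F (\<lambda>k. c * y (d k)) (e i) / c = y i"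
    by blast
  have "F (\<lambda>k. c * y (d k)) k = c * y (d k)" if "k \<in> N" for k
    using y(2)[rule_format, OF dN(1)[OF that]] dN(2)[OF that] c by (simp add: field_simps)
  moreover have "\<forall>k\<in>N. c * y (d k) \<in> {0..c}"
    using y dN c by (auto simp: mult_left_le)
  ultimately show ?thesis by (intro exI[of _ "\<lambda>k. c * y (d k)"]) auto
qed

text \<open>A best reply map is continuous when best replies are unique, because every limit of best
  replies is a best reply.\<close>

lemma equilibrium_of_unique_best_replies:
  fixes w :: "'k \<Rightarrow> ('k \<Rightarrow> real) \<Rightarrow> real"
  assumes fin: "finite N" and c: "c > 0"
    and cont: "\<And>X x i. \<lbrakk>\<forall>k. \<forall>j\<in>N. X k j \<in> {0..c}; \<forall>j\<in>N. (\<lambda>k. X k j) \<longlonglongrightarrow> x j; i \<in> N\<rbrakk>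
                 \<Longrightarrow> (\<lambda>k. w i (X k)) \<longlonglongrightarrow> w i x"
    and uniq: "\<And>x i p q. \<lbrakk>\<forall>j\<in>N. x j \<in> {0..c}; i \<in> N; p \<in> {0..c}; q \<in> {0..c};
                 \<forall>s\<in>{0..c}. w i (x(i := s)) \<le> w i (x(i := p));
                 \<forall>s\<in>{0..c}. w i (x(i := s)) \<le> w i (x(i := q))\<rbrakk> \<Longrightarrow> p = q"
  shows "\<exists>x. (\<forall>j\<in>N. x j \<in> {0..c}) \<and> (\<forall>i\<in>N. \<forall>s\<in>{0..c}. w i (x(i := s)) \<le> w i x)"
proof -
  define best where "best x i p \<longleftrightarrow> p \<in> {0..c} \<and> (\<forall>s\<in>{0..c}. w i (x(i := s)) \<le> w i (x(i := p)))" for x i p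
  have ex: "\<exists>p. best x i p" if x: "\<forall>j\<in>N. x j \<in> {0..c}" and i: "i \<in> N" for x i
  proof -
    \<comment> \<open>The case of \<open>cont\<close> in which only coordinate \<open>i\<close>
      varies along the sequence.\<close>
    have "continuous_on {0..c} (\<lambda>s. w i (x(i := s)))"
      unfolding continuous_on_sequentially
    proof safe
      fix p and s :: "nat \<Rightarrow> real"
      assume "\<forall>n. s n \<in> {0..c}" "s \<longlonglongrightarrow> p"
      then show "((\<lambda>s. w i (x(i := s))) \<circ> s) \<longlonglongrightarrow> w i (x(i := p))"
        unfolding o_def using x by (intro cont i) auto
    qed
    then show ?thesis
      using continuous_attains_sup[of "{0..c}" "\<lambda>s. w i (x(i := s))"] c unfolding best_def by force
  qed
  define F where "F x i = (SOME p. best x i p)" for x i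
  have F: "best x i (F x i)" if "\<forall>j\<in>N. x j \<in> {0..c}" "i \<in> N" for x i
    unfolding F_def using ex[OF that] by (rule someI_ex)
  have best_unique: "p = q" if "best x i p" "best x i q" "\<forall>j\<in>N. x j \<in> {0..c}" "i \<in> N" for x i p q
    by (rule uniq[OF that(3,4)]) (use that in \<open>auto simp: best_def\<close>)
  have "\<exists>x. (\<forall>j\<in>N. x j \<in> {0..c}) \<and> (\<forall>i\<in>N. F x i = x i)"
  proof (rule brouwer_finite_cube[OF fin c])
    show "F x i \<in> {0..c}" if "\<forall>j\<in>N. x j \<in> {0..c}" "i \<in> N" for x i
      using F[OF that] by (simp add: best_def)
  next
    fix X x i
    assume X: "\<forall>k. \<forall>j\<in>N. X k j \<in> {0..c}" and lim: "\<forall>j\<in>N. (\<lambda>k. X k j) \<longlonglongrightarrow> x j" and i: "i \<in> N"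
    have x: "\<forall>j\<in>N. x j \<in> {0..c}"
    proof
      fix j assume "j \<in> N"
      with X lim show "x j \<in> {0..c}"
        using closed_sequentially[of "{0..c}" "\<lambda>k. X k j" "x j"] by simp
    qed
    show "(\<lambda>k. F (X k) i) \<longlonglongrightarrow> F x i"
    proof (rule ccontr)
      assume "\<not> ?thesis"
      \<comment> \<open>Failure of convergence keeps best replies outside \<open>U\<close> along a
        subsequence. By compactness a further subsequence converges to some \<open>p\<close>; that
        \<open>p\<close> is again a best reply, so uniqueness puts it into \<open>U\<close>.\<close>
      then obtain U where U: "open U" "F x i \<in> U" "\<not> (\<forall>\<^sub>F k in sequentially. F (X k) i \<in> U)"
        unfolding tendsto_def by blast
      then have "\<exists>\<^sub>F k in sequentially. F (X k) i \<notin> U"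
        by (simp add: frequently_def)
      then have "infinite {k. F (X k) i \<notin> U}"
        by (simp add: frequently_cofinite cofinite_eq_sequentially[symmetric])
      then obtain r :: "nat \<Rightarrow> nat" where r: "strict_mono r" "\<And>k. F (X (r k)) i \<notin> U"
        using infinite_enumerate by blast
      have F0c: "F (X (r k)) i \<in> {0..c}" for k
        using F[of "X (r k)" i] X i by (auto simp: best_def)
      then obtain p s where s: "strict_mono (s :: nat \<Rightarrow> nat)"
        and "p \<in> {0..c}" "((\<lambda>k. F (X (r k)) i) \<circ> s) \<longlonglongrightarrow> p"
        using compact_Icc[of 0 c] unfolding compact_eq_seq_compact_metric seq_compact_def by meson
      then have p: "p \<in> {0..c}" "(\<lambda>k. F (X (r (s k))) i) \<longlonglongrightarrow> p" by (auto simp: o_def)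
      have lim': "(\<lambda>k. X (r (s k)) j) \<longlonglongrightarrow> x j" if "j \<in> N" for j
        using LIMSEQ_subseq_LIMSEQ[OF lim[rule_format, OF that] strict_mono_o[OF r(1) s]]
        by (simp add: o_def)
      \<comment> \<open>The deviation \<open>t\<close> stays fixed while the profiles vary, so
        optimality passes to the limit by \<open>cont\<close> on both sides.\<close>
      have "w i (x(i := t)) \<le> w i (x(i := p))" if t: "t \<in> {0..c}" for t
      proof (rule LIMSEQ_le)
        show "(\<lambda>k. w i ((X (r (s k)))(i := t))) \<longlonglongrightarrow> w i (x(i := t))"
          using X lim' t by (intro cont i) auto
        show "(\<lambda>k. w i ((X (r (s k)))(i := F (X (r (s k))) i))) \<longlonglongrightarrow> w i (x(i := p))"
          using X lim' p F0c by (intro cont i) auto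
        show "\<exists>M. \<forall>k\<ge>M. w i ((X (r (s k)))(i := t)) \<le> w i ((X (r (s k)))(i := F (X (r (s k))) i))"
          using F[of "X (r (s _))" i] X i t by (auto simp: best_def)
      qed
      then have "best x i p" using p by (simp add: best_def)
      then have "p = F x i" using best_unique F x i by blast
      then have "\<forall>\<^sub>F k in sequentially. F (X (r (s k))) i \<in> U"
        using p(2) U topological_tendstoD by blast
      then show False using r(2) by simp
    qed
  qed
  then obtain x where x: "\<forall>j\<in>N. x j \<in> {0..c}" and fixp: "\<And>i. i \<in> N \<Longrightarrow> F x i = x i" by blast
  have "w i (x(i := s)) \<le> w i x" if "i \<in> N" "s \<in> {0..c}" for i s
    using F[OF x that(1)] that fixp[OF that(1)] by (simp add: best_def)
  with x show ?thesis by blast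
qed

subsection \<open>Market areas\<close>

text \<open>The common summand \<open>\<beta>\<close> cancels in every comparison, and a minimiser
  is unique exactly when it beats each competitor strictly.\<close>

lemma market_area_eq:
  assumes "i \<in> K"
  shows "market_area K pos \<beta> P i =
    {x. \<forall>j\<in>K - {i}. P i + (norm (x - pos i))\<^sup>2 < P j + (norm (x - pos j))\<^sup>2}"
proof -
  have "owners K pos \<beta> P x = {i} \<longleftrightarrow> (\<forall>j\<in>K - {i}. aggregate_price pos \<beta> P i x < aggregate_price pos \<beta> P j x)" for x
  proof
    assume own: "owners K pos \<beta> P x = {i}"
    then have le: "aggregate_price pos \<beta> P i x \<le> aggregate_price pos \<beta> P j x" if "j \<in> K" for j
      using that unfolding owners_def is_arg_min_linorder by blast
    show "\<forall>j\<in>K - {i}. aggregate_price pos \<beta> P i x < aggregate_price pos \<beta> P j x"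
    proof (rule ballI, rule ccontr)
      fix j assume j: "j \<in> K - {i}" and "\<not> aggregate_price pos \<beta> P i x < aggregate_price pos \<beta> P j x"
      then have "j \<in> owners K pos \<beta> P x"
        using le unfolding owners_def is_arg_min_linorder by (auto simp: not_less intro: order_trans)
      with own j show False by blast
    qed
  next
    assume *: "\<forall>j\<in>K - {i}. aggregate_price pos \<beta> P i x < aggregate_price pos \<beta> P j x"
    then have "aggregate_price pos \<beta> P i x \<le> aggregate_price pos \<beta> P j x" if "j \<in> K" for j
      using that by (cases "j = i") (auto intro: less_imp_le)
    with assms * show "owners K pos \<beta> P x = {i}"
      unfolding owners_def is_arg_min_linorder by (auto simp: not_le[symmetric])
  qed
  then show ?thesis by (simp add: market_area_def aggregate_price_def)
qed

text \<open>The quadratic terms cancel, leaving a line with nonzero normal vector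
  \<open>2 *\<^sub>R (b - a)\<close>.\<close>

lemma negligible_bisector:
  assumes "a \<noteq> (b :: real^2)"
  shows "negligible {x. p + (norm (x - a))\<^sup>2 = q + (norm (x - b))\<^sup>2}"
proof -
  have "{x. p + (norm (x - a))\<^sup>2 = q + (norm (x - b))\<^sup>2}
      = {x. (2 *\<^sub>R (b - a)) \<bullet> x = q - p + b \<bullet> b - a \<bullet> a}"
    by (auto simp: power2_norm_eq_inner inner_diff inner_commute algebra_simps)
  then show ?thesis
    using assms negligible_hyperplane[of "2 *\<^sub>R (b - a)"] by auto
qed

section \<open>Cells and areas under the price bound \<open>c\<close>\<close>

locale market =
  fixes K :: "'k set" and pos :: "'k \<Rightarrow> real^2" and c r :: real
  assumes inj: "inj_on pos K"
    and locally_finite: "\<And>R. bounded R \<Longrightarrow> finite {k \<in> K. pos k \<in> R}"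
    and covering: "\<And>x. \<exists>k\<in>K. pos k \<in> cball x r"
    and c_pos: "c > 0"
begin

definition admissible :: "('k \<Rightarrow> real) \<Rightarrow> bool"
  where "admissible P \<longleftrightarrow> (\<forall>k\<in>K. P k \<in> {0..c})"

text \<open>With all prices in \<open>{0..c}\<close>, every cell lies within distance \<open>radius\<close> of its company, and there
  only the finitely many rivals can be cheaper.\<close>

definition radius :: real
  where "radius = \<bar>r\<bar> + c + 1"

definition rivals :: "'k \<Rightarrow> 'k set"
  where "rivals i = {k \<in> K. pos k \<in> cball (pos i) (2 * radius + c + 1)} - {i}"

text \<open>The form of \<open>market_area\<close> given by \<open>market_area_eq\<close>: a cell of
  the power (Laguerre) diagram with weights \<open>- P k\<close>.\<close>

definition cell :: "('k \<Rightarrow> real) \<Rightarrow> 'k \<Rightarrow> (real^2) set"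
  where "cell P i = {x. \<forall>j\<in>K - {i}. P i + (norm (x - pos i))\<^sup>2 < P j + (norm (x - pos j))\<^sup>2}"

lemma finite_rivals: "finite (rivals i)"
  unfolding rivals_def by (intro finite_Diff locally_finite) simp

text \<open>Some company \<open>k\<close> lies within \<open>r\<close> of the customer and, up to
  \<open>\<beta>\<close>, costs at most \<open>c + r^2\<close>. Either \<open>k\<close> is
  \<open>i\<close> itself, or \<open>i\<close> is cheaper still and, its price being nonnegative,
  must be close.\<close>

lemma cell_subset_ball:
  assumes "admissible P" "i \<in> K"
  shows "cell P i \<subseteq> ball (pos i) radius"
proof
  fix x assume x: "x \<in> cell P i"
  obtain k where k: "k \<in> K" "norm (x - pos k) \<le> r"
    using covering[of x] by (auto simp: dist_norm)
  show "x \<in> ball (pos i) radius"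
  proof (cases "k = i")
    case True
    then show ?thesis using k c_pos by (auto simp: dist_norm norm_minus_commute radius_def)
  next
    case False
    have "P i + (norm (x - pos i))\<^sup>2 < P k + (norm (x - pos k))\<^sup>2"
      using x k False by (simp add: cell_def)
    moreover have "0 \<le> P i" "P k \<le> c" using assms k by (auto simp: admissible_def)
    ultimately have "(norm (x - pos i))\<^sup>2 < c + (norm (x - pos k))\<^sup>2" by linarith
    also have "\<dots> \<le> c + r\<^sup>2" using k by (intro add_left_mono power_mono) auto
    \<comment> \<open>The square of \<open>radius\<close> contains both \<open>r^2\<close> and
      \<open>2 * c\<close>.\<close>
    also have "\<dots> \<le> radius\<^sup>2"
      using c_pos mult_nonneg_nonneg[of "\<bar>r\<bar>" c] by (simp add: radius_def power2_eq_square algebra_simps)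
    finally have "norm (x - pos i) < radius"
      by (rule power2_less_imp_less) (use c_pos in \<open>simp add: radius_def\<close>)
    then show ?thesis by (simp add: dist_norm norm_minus_commute)
  qed
qed

text \<open>From points of the ball, a company outside \<open>rivals i\<close> is farther than
  \<open>radius + c + 1\<close> and too expensive at any price. The finite intersection gives
  openness and lets eventual statements be combined over rivals.\<close>

lemma cell_eq_rivals:
  assumes "admissible P" "i \<in> K"
  shows "cell P i = ball (pos i) radius \<inter>
    (\<Inter>j\<in>rivals i. {x. P i + (norm (x - pos i))\<^sup>2 < P j + (norm (x - pos j))\<^sup>2})"
proof (intro set_eqI iffI)
  fix x assume "x \<in> cell P i"
  then show "x \<in> ball (pos i) radius \<inter>
    (\<Inter>j\<in>rivals i. {x. P i + (norm (x - pos i))\<^sup>2 < P j + (norm (x - pos j))\<^sup>2})"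
    using cell_subset_ball[OF assms] by (auto simp: cell_def rivals_def)
next
  fix x assume x: "x \<in> ball (pos i) radius \<inter>
    (\<Inter>j\<in>rivals i. {x. P i + (norm (x - pos i))\<^sup>2 < P j + (norm (x - pos j))\<^sup>2})"
  have "P i + (norm (x - pos i))\<^sup>2 < P j + (norm (x - pos j))\<^sup>2" if j: "j \<in> K - {i}" for j
  proof (cases "j \<in> rivals i")
    case True
    with x show ?thesis by blast
  next
    case False
    have near: "norm (x - pos i) < radius"
      using x by (simp add: dist_norm norm_minus_commute)
    have "2 * radius + c + 1 < dist (pos i) (pos j)"
      using False j by (auto simp: rivals_def)
    also have "\<dots> \<le> norm (x - pos i) + norm (x - pos j)"
      using norm_triangle_ineq4[of "x - pos j" "x - pos i"] by (simp add: dist_norm)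
    finally have far: "radius + c + 1 < norm (x - pos j)" using near by simp
    have R: "1 \<le> radius" using c_pos by (simp add: radius_def)
    have "P i + (norm (x - pos i))\<^sup>2 \<le> c + radius\<^sup>2"
      using assms near unfolding admissible_def by (intro add_mono power_mono) auto
    also have "\<dots> < (radius + c + 1)\<^sup>2"
      using c_pos R mult_nonneg_nonneg[of radius c] by (simp add: power2_eq_square algebra_simps add_pos_nonneg)
    also have "\<dots> \<le> (norm (x - pos j))\<^sup>2"
      using far c_pos R by (intro power_mono) auto
    also have "\<dots> \<le> P j + (norm (x - pos j))\<^sup>2" using assms j unfolding admissible_def by auto
    finally show ?thesis .
  qed
  then show "x \<in> cell P i" by (simp add: cell_def)
qed

lemma open_cell: "admissible P \<Longrightarrow> i \<in> K \<Longrightarrow> open (cell P i)"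
  unfolding cell_eq_rivals
  by (intro open_Int open_ball open_INT finite_rivals ballI open_Collect_less continuous_intros)

lemma bounded_cell: "admissible P \<Longrightarrow> i \<in> K \<Longrightarrow> bounded (cell P i)"
  using bounded_subset[OF bounded_ball cell_subset_ball] .

definition area :: "('k \<Rightarrow> real) \<Rightarrow> 'k \<Rightarrow> real"
  where "area P i = measure lebesgue (cell P i)"

text \<open>Dominated convergence of indicators, with the common ball as majorant. Off the finitely
  many bisectors of the limit prices the indicators are eventually constant.\<close>

lemma area_tendsto:
  assumes adm: "\<And>n. admissible (P n)" and i: "i \<in> K"
    and lim: "\<And>k. k \<in> K \<Longrightarrow> (\<lambda>n. P n k) \<longlonglongrightarrow> Q k"
  shows "(\<lambda>n. area (P n) i) \<longlonglongrightarrow> area Q i"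
proof -
  have admQ: "admissible Q"
    unfolding admissible_def
  proof
    fix k assume k: "k \<in> K"
    show "Q k \<in> {0..c}"
      using closed_sequentially[OF _ _ lim[OF k], of "{0..c}"] adm k unfolding admissible_def by simp
  qed
  let ?g = "\<lambda>P j x. P j + (norm (x - pos j))\<^sup>2"
  let ?N = "\<Union>j\<in>rivals i. {x. ?g Q i x = ?g Q j x}"
  have "negligible {x. ?g Q i x = ?g Q j x}" if "j \<in> rivals i" for j
    using that i inj by (intro negligible_bisector) (auto simp: rivals_def dest: inj_onD)
  then have N: "negligible ?N" using finite_rivals by blast
  have conv: "(\<lambda>n. indicat_real (cell (P n) i) x) \<longlonglongrightarrow> indicat_real (cell Q i) x" if x: "x \<notin> ?N" for x
  proof -
    \<comment> \<open>Off the bisector the limiting price difference is nonzero, so its sign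
      settles.\<close>
    have "\<forall>\<^sub>F n in sequentially. (?g (P n) i x < ?g (P n) j x) = (?g Q i x < ?g Q j x)" if j: "j \<in> rivals i" for j
    proof -
      have diff: "(\<lambda>n. ?g (P n) j x - ?g (P n) i x) \<longlonglongrightarrow> ?g Q j x - ?g Q i x"
        using lim i j by (auto intro!: tendsto_intros simp: rivals_def)
      consider "0 < ?g Q j x - ?g Q i x" | "?g Q j x - ?g Q i x < 0" using x j by force
      then show ?thesis
      proof cases
        case 1
        then show ?thesis
          using order_tendstoD(1)[OF diff 1] by (auto elim!: eventually_mono)
      next
        case 2
        then show ?thesis
          using order_tendstoD(2)[OF diff 2] by (auto elim!: eventually_mono)
      qed
    qed
    then have "\<forall>\<^sub>F n in sequentially. \<forall>j\<in>rivals i. (?g (P n) i x < ?g (P n) j x) = (?g Q i x < ?g Q j x)"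
      by (intro eventually_ball_finite finite_rivals ballI)
    then have "\<forall>\<^sub>F n in sequentially. indicat_real (cell (P n) i) x = indicat_real (cell Q i) x"
      by (rule eventually_mono) (simp add: cell_eq_rivals adm admQ i indicator_def)
    then show ?thesis by (rule tendsto_eventually)
  qed
  have meas: "cell P i \<in> lmeasurable" if "admissible P" for P
    using lmeasurable_open bounded_cell open_cell that i by blast
  have "(\<lambda>n. integral\<^sup>L lebesgue (indicat_real (cell (P n) i))) \<longlonglongrightarrow> integral\<^sup>L lebesgue (indicat_real (cell Q i))"
  proof (rule integral_dominated_convergence)
    show "indicat_real (cell Q i) \<in> borel_measurable lebesgue" "indicat_real (cell (P n) i) \<in> borel_measurable lebesgue" for n
      using meas adm admQ by (auto intro!: borel_measurable_indicator)
    show "integrable lebesgue (indicat_real (ball (pos i) radius))"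
      by (rule integrable_real_indicator)
         (use lmeasurable_ball[of "pos i" radius] in \<open>auto simp: fmeasurable_def simp del: lmeasurable_ball\<close>)
    show "AE x in lebesgue. (\<lambda>n. indicat_real (cell (P n) i) x) \<longlonglongrightarrow> indicat_real (cell Q i) x"
      by (rule AE_I'[of ?N]) (use N conv negligible_iff_null_sets in auto)
    show "AE x in lebesgue. norm (indicat_real (cell (P n) i) x) \<le> indicat_real (ball (pos i) radius) x" for n
      using cell_subset_ball[OF adm i, of n] by (intro AE_I2) (auto split: split_indicator)
  qed
  then show ?thesis by (simp add: area_def)
qed

text \<open>The difference \<open>?h\<close> of squared distances is affine, so each defining
  inequality can be averaged.\<close>

lemma midpoint_in_cell:
  assumes x: "x \<in> cell (P(i := p)) i" and y: "y \<in> cell (P(i := q)) i"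
  shows "midpoint x y \<in> cell (P(i := (p + q) / 2)) i"
  unfolding cell_def
proof (intro CollectI ballI)
  fix j assume j: "j \<in> K - {i}"
  let ?h = "\<lambda>x. (norm (x - pos j))\<^sup>2 - (norm (x - pos i))\<^sup>2"
  have "p < P j + ?h x" "q < P j + ?h y"
    using x y j by (force simp: cell_def)+
  moreover have "?h (midpoint x y) = (?h x + ?h y) / 2"
    by (simp add: midpoint_def power2_norm_eq_inner inner_diff inner_commute inner_add field_simps)
  ultimately show "(P(i := (p + q) / 2)) i + (norm (midpoint x y - pos i))\<^sup>2
      < (P(i := (p + q) / 2)) j + (norm (midpoint x y - pos j))\<^sup>2"
    using j by (simp add: field_simps)
qed

text \<open>The product form also covers cells that are empty at high prices.\<close>

lemma area_log_concave:
  assumes "admissible (P(i := p))" "admissible (P(i := q))" "i \<in> K"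
  shows "area (P(i := p)) i * area (P(i := q)) i \<le> (area (P(i := (p + q) / 2)) i)\<^sup>2"
proof -
  have adm: "admissible (P(i := (p + q) / 2))"
    using assms unfolding admissible_def by (auto split: if_splits)
  show ?thesis
    unfolding area_def
    by (intro brunn_minkowski_midpoint borel_open open_cell bounded_cell midpoint_in_cell assms adm)
qed

text \<open>Below every squared distance to a rival, the company wins its own position, and the cell
  is open.\<close>

lemma area_pos_at_low_price:
  assumes P: "admissible P" and i: "i \<in> K"
  shows "\<exists>p\<in>{0<..c}. 0 < area (P(i := p)) i"
proof -
  let ?d = "\<lambda>j. (norm (pos i - pos j))\<^sup>2"
  \<comment> \<open>Inserting \<open>c\<close> keeps the minimum within the price range and the set
    nonempty; halving it makes the inequalities strict.\<close>
  let ?D = "insert c (?d ` rivals i)"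
  have "\<forall>d\<in>?D. 0 < d"
    using c_pos i inj by (auto simp: rivals_def dest: inj_onD)
  then have D: "0 < Min ?D" using finite_rivals by (subst Min_gr_iff) auto
  define p where "p = Min ?D / 2"
  have pc: "Min ?D \<le> c" using finite_rivals by simp
  have p: "p \<in> {0<..c}" using D pc c_pos by (simp add: p_def)
  have adm: "admissible (P(i := p))" using P p by (auto simp: admissible_def)
  have "p < ?d j" if "j \<in> rivals i" for j
  proof -
    have "Min ?D \<le> ?d j" using finite_rivals that by (intro Min_le) auto
    then show ?thesis using D by (simp add: p_def)
  qed
  moreover have "0 \<le> P j" if "j \<in> rivals i" for j
    using P that by (auto simp: admissible_def rivals_def)
  ultimately have "pos i \<in> cell (P(i := p)) i"
    using c_pos unfolding cell_eq_rivals[OF adm i]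
    by (auto simp: radius_def rivals_def add_strict_increasing2)
  then have "\<not> negligible (cell (P(i := p)) i)"
    using open_not_negligible[OF open_cell[OF adm i]] by blast
  moreover have "cell (P(i := p)) i \<in> lmeasurable"
    using lmeasurable_open bounded_cell open_cell adm i by blast
  ultimately have "area (P(i := p)) i \<noteq> 0"
    by (simp add: area_def negligible_iff_measure)
  then show ?thesis using p by (intro bexI[of _ p]) (auto simp: area_def less_le)
qed

text \<open>The product of the two equal optimal payoffs is compared with the squared payoff at the
  midpoint price, which would be strictly larger.\<close>

lemma unique_best_reply:
  assumes P: "admissible P" and i: "i \<in> K" and p: "p \<in> {0..c}" and q: "q \<in> {0..c}"
    and max_p: "\<And>s. s \<in> {0..c} \<Longrightarrow> s * area (P(i := s)) i \<le> p * area (P(i := p)) i"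
    and max_q: "\<And>s. s \<in> {0..c} \<Longrightarrow> s * area (P(i := s)) i \<le> q * area (P(i := q)) i"
  shows "p = q"
proof (rule ccontr)
  assume "p \<noteq> q"
  let ?a = "\<lambda>s. area (P(i := s)) i"
  define m where "m = (p + q) / 2"
  have m: "m \<in> {0..c}" using p q by (auto simp: m_def)
  define v where "v = p * ?a p"
  have eq: "q * ?a q = v" unfolding v_def using max_p[OF q] max_q[OF p] by simp
  obtain s where s: "s \<in> {0<..c}" "0 < ?a s" using area_pos_at_low_price[OF P i] by blast
  then have "0 < s * ?a s" by simp
  also have "\<dots> \<le> v" using s max_p[of s] by (simp add: v_def)
  finally have v: "0 < v" .
  have a0: "0 \<le> ?a s" for s by (simp add: area_def)
  \<comment> \<open>Positive areas make the later strict inequality survive multiplication.\<close>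
  have "0 < ?a p" "0 < ?a q"
    using v eq a0[of p] a0[of q] by (auto simp: v_def less_le)
  have adm: "admissible (P(i := s))" if "s \<in> {0..c}" for s
    using P that by (auto simp: admissible_def)
  have "p * q < m\<^sup>2"
  proof -
    have "0 < (p - q)\<^sup>2" using \<open>p \<noteq> q\<close> by simp
    then show ?thesis by (simp add: m_def power2_eq_square field_simps)
  qed
  have "v\<^sup>2 = (p * q) * (?a p * ?a q)"
  proof -
    have "v\<^sup>2 = (p * ?a p) * (q * ?a q)" unfolding eq by (simp add: v_def power2_eq_square)
    then show ?thesis by simp
  qed
  also have "\<dots> < m\<^sup>2 * (?a p * ?a q)"
    using \<open>p * q < m\<^sup>2\<close> \<open>0 < ?a p\<close> \<open>0 < ?a q\<close> by (intro mult_strict_right_mono) auto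
  also have "\<dots> \<le> m\<^sup>2 * (?a m)\<^sup>2"
    using area_log_concave[OF adm[OF p] adm[OF q] i] by (intro mult_left_mono) (auto simp: m_def)
  also have "\<dots> = (m * ?a m)\<^sup>2" by (simp add: power_mult_distrib)
  also have "\<dots> \<le> v\<^sup>2"
    using max_p[OF m] m a0 by (intro power_mono) (auto simp: v_def)
  finally show False by simp
qed

end

section \<open>Equilibrium of the pricing game\<close>

theorem theorem5:
  fixes K :: "'k set" and pos :: "'k \<Rightarrow> real^2" and \<beta> B :: real
  assumes "infinite K"
    and "inj_on pos K"
    and "\<And>R. bounded R \<Longrightarrow> finite {k \<in> K. pos k \<in> R}"
    and "\<exists>r>0. \<forall>c. \<exists>k\<in>K. pos k \<in> cball c r"
    and "B > 0"
    and "players K pos B \<noteq> {}"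
    and "\<beta> \<ge> 0"
  shows "\<exists>T. \<forall>P_upper>T. \<forall>P0 :: 'k \<Rightarrow> real.
           (\<forall>j \<in> K - players K pos B. P0 j \<in> {0..P_upper}) \<longrightarrow>
           (\<exists>P. nash_equilibrium K pos \<beta> (players K pos B) P_upper P0 P)"
proof (intro exI[of _ 0] allI impI)
  fix c :: real and P0 :: "'k \<Rightarrow> real"
  assume c: "0 < c" and P0: "\<forall>j \<in> K - players K pos B. P0 j \<in> {0..c}"
  let ?N = "players K pos B"
  obtain r where "\<forall>c. \<exists>k\<in>K. pos k \<in> cball c r" using assms(4) by blast
  then interpret market K pos c r
    using assms(2,3) c by unfold_locales auto
  have NK: "?N \<subseteq> K" by (auto simp: players_def)
  have "bounded {x :: real^2. infnorm x \<le> B / 2}"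
  proof -
    have "norm x \<le> sqrt (real DIM(real^2)) * (B / 2)" if "infnorm x \<le> B / 2" for x :: "real^2"
      using norm_le_infnorm[of x] that by (meson mult_left_mono order_trans real_sqrt_ge_zero of_nat_0_le_iff)
    then show ?thesis unfolding bounded_iff by blast
  qed
  from locally_finite[OF this] have fin: "finite ?N" by (simp add: players_def)
  \<comment> \<open>Completion with the fixed prices \<open>P0\<close> takes place inside
    \<open>w\<close>, so only the players' coordinates have to converge.\<close>
  define w where "w i P = P i * area (override_on P0 P ?N) i" for i P
  have adm: "admissible (override_on P0 P ?N)" if "\<forall>j\<in>?N. P j \<in> {0..c}" for P
    using that P0 by (auto simp: admissible_def override_on_def)
  have upd: "override_on P0 (P(i := s)) ?N = (override_on P0 P ?N)(i := s)" if "i \<in> ?N" for P i and s :: real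
    using that by (auto simp: override_on_def)
  have pay: "payoff K pos \<beta> (override_on P0 P ?N) i = w i P" if "i \<in> ?N" for i P
    using that NK by (auto simp: payoff_def w_def area_def cell_def market_area_eq)
  have "\<exists>P. (\<forall>j\<in>?N. P j \<in> {0..c}) \<and> (\<forall>i\<in>?N. \<forall>s\<in>{0..c}. w i (P(i := s)) \<le> w i P)"
  proof (rule equilibrium_of_unique_best_replies[OF fin c])
    fix X P i
    assume X: "\<forall>k. \<forall>j\<in>?N. X k j \<in> {0..c}" and lim: "\<forall>j\<in>?N. (\<lambda>k. X k j) \<longlonglongrightarrow> P j" and i: "i \<in> ?N"
    have "(\<lambda>n. area (override_on P0 (X n) ?N) i) \<longlonglongrightarrow> area (override_on P0 P ?N) i"
    proof (rule area_tendsto)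
      show "(\<lambda>n. override_on P0 (X n) ?N k) \<longlonglongrightarrow> override_on P0 P ?N k" for k
        using lim by (cases "k \<in> ?N") auto
    qed (use adm X i NK in auto)
    with lim i show "(\<lambda>n. w i (X n)) \<longlonglongrightarrow> w i P"
      unfolding w_def by (intro tendsto_mult) auto
  next
    fix P i p q
    assume *: "\<forall>j\<in>?N. P j \<in> {0..c}" "i \<in> ?N" "p \<in> {0..c}" "q \<in> {0..c}"
      "\<forall>s\<in>{0..c}. w i (P(i := s)) \<le> w i (P(i := p))" "\<forall>s\<in>{0..c}. w i (P(i := s)) \<le> w i (P(i := q))"
    show "p = q"
      by (rule unique_best_reply[OF adm[OF *(1)], of i])
         (use * NK in \<open>auto simp: w_def upd\<close>)
  qed
  then obtain P where P: "\<forall>j\<in>?N. P j \<in> {0..c}" and opt: "\<And>i s. i \<in> ?N \<Longrightarrow> s \<in> {0..c} \<Longrightarrow> w i (P(i := s)) \<le> w i P"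
    by blast
  \<comment> \<open>An equilibrium must be extensional on \<open>?N\<close>; restricting is harmless
    since \<open>override_on\<close> replaces all values outside \<open>?N\<close>.\<close>
  have w_restrict: "w i ((restrict P ?N)(i := s)) = w i (P(i := s))" if "i \<in> ?N" for i s
  proof -
    have "override_on P0 ((restrict P ?N)(i := s)) ?N = override_on P0 (P(i := s)) ?N"
      by (auto simp: override_on_def)
    then show ?thesis by (simp add: w_def)
  qed
  have "nash_equilibrium K pos \<beta> ?N c P0 (restrict P ?N)"
    unfolding nash_equilibrium_def is_arg_max_linorder
    using P opt by (auto simp: pay w_restrict restrict_PiE_iff)
  then show "\<exists>P. nash_equilibrium K pos \<beta> ?N c P0 P" by blast
qed

end
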